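(* Let $D$, $f$, $m$, $\theta^*$, $M$, $\sigma$ and the SGM iterates $(\theta_j)$ satisfy the standing assumptions in the context. Consider a stage of the constant-and-drop learning strategy with constant step-size $t_j=a$ for all $j\geq 0$, where $0<a<\frac1m$, and suppose the momentum weight sequence in the stage satisfies $\eta_j<1$ for all $j$ and $$\frac{\sum_{i=0}^j\eta_i}{j+1}\to 0\quad\text{as } j\to\infty .$$ Then there exists $N_a$ such that for all $N\ge N_a$, $$E\Bigl\{\Bigl\|\frac{1}{N+1}\sum_{i=0}^{N}\theta_i-\theta^*\Bigr\|^2\Bigr\}\le\frac{2(M+\sigma^2)}{m}\,a .$$
   Context: $\|\cdot\|$ is the Euclidean norm and $E$ denotes expectation. Assumption 1. $D\subset\mathbb R^n$ is a compact convex set with diameter at most $L$. The function $f:\mathbb R^n\to\mathbb R$ is $m$-strongly convex over $D$ ($m>0$): for all $\theta,\theta'\in D$ and $s\in\partial f(\theta)$, $f(\theta')\ge f(\theta)+s^\top(\theta'-\theta)+\frac m2\|\theta'-\theta\|^2$. The minimizer $\theta^*$ of $f$ over $D$ lies in the interior of $D$. Assumption 2. The stochastic sub-gradient used at step $j$ has the form $g(\theta_j;z_j)=s_j+n_j$, where $s_j\in\partial f(\theta_j)$, $E\{n_j\}=0$, the variance of $n_j$ is bounded by $\sigma^2$ (i.e. $E\{\|n_j\|^2\}\le\sigma^2$), and $n_j$ is independent of $\theta_j$, of $s_j$, and of $n_i$ for $i\ne j$. Assumption 3. $\|s\|\le\sqrt M$ for every $\theta\in D$ and every $s\in\partial f(\theta)$.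 SGM (stochastic gradient with Polyak momentum): with initial guesses $\theta_{-1},\theta_0\in D$, $$\theta_{j+1}=P_D\bigl(\theta_j-t_j\,g(\theta_j;z_j)+\eta_j(\theta_j-\theta_{j-1})\bigr),\qquad j\ge0,$$ where $P_D$ is the orthogonal projection onto $D$, $t_j>0$ is the step-size and $\eta_j<1$ is the momentum weight. Constant-and-drop strategy: the learning sequence is divided into stages, and within each stage SGM is run with a constant step-size. The iterates within the stage under consideration are indexed from $0$.
   Formalization: The momentum weights are assumed nonnegative, 0 ≤ η_j < 1; with only η_j < 1 the claim fails, e.g. f(x)=x²/2 on [-1,1], no noise, a=0.001, start 1, weights repeating 0.9, 0.9, 0.9, 0.9, -3.6. *)

theory Defs
  imports "HOL-Probability.Probability"
begin

definition subdifferential :: "(real ^ 'n \<Rightarrow> real) \<Rightarrow> real ^ 'n \<Rightarrow> (real ^ 'n) set" where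
  "subdifferential f x = {s. \<forall>y. f y \<ge> f x + s \<bullet> (y - x)}"

definition strongly_convex_over :: "real \<Rightarrow> (real ^ 'n) set \<Rightarrow> (real ^ 'n \<Rightarrow> real) \<Rightarrow> bool" where
  "strongly_convex_over m D f \<longleftrightarrow>
     (\<forall>x\<in>D. \<forall>y\<in>D. \<forall>s\<in>subdifferential f x.
        f y \<ge> f x + s \<bullet> (y - x) + m / 2 * (norm (y - x))\<^sup>2)"

text \<open>
  Iterates carry integer indices because the momentum term at step 0 uses the second
  initial guess \<open>\<theta> (-1)\<close>; values at indices below \<open>-1\<close> are irrelevant. The initial guesses
  may be random, since a stage starts from the output of the preceding one.
  For nonempty closed convex \<open>D\<close>, \<open>closest_point D\<close> is the orthogonal projection onto \<open>D\<close>.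
\<close>

definition sgm_iterates ::
  "'w measure \<Rightarrow> (real ^ 'n) set \<Rightarrow> (real ^ 'n \<Rightarrow> 'z \<Rightarrow> real ^ 'n) \<Rightarrow> (nat \<Rightarrow> 'w \<Rightarrow> 'z) \<Rightarrow>
   (nat \<Rightarrow> real) \<Rightarrow> (nat \<Rightarrow> real) \<Rightarrow> (int \<Rightarrow> 'w \<Rightarrow> real ^ 'n) \<Rightarrow> bool" where
  "sgm_iterates P D g z t \<eta> \<theta> \<longleftrightarrow>
     \<theta> (-1) \<in> borel_measurable P \<and> \<theta> 0 \<in> borel_measurable P \<and>
     (\<forall>\<omega>\<in>space P. \<theta> (-1) \<omega> \<in> D \<and> \<theta> 0 \<omega> \<in> D) \<and>
     (\<forall>j. \<forall>\<omega>\<in>space P.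
        \<theta> (int j + 1) \<omega> =
          closest_point D (\<theta> (int j) \<omega> - t j *\<^sub>R g (\<theta> (int j) \<omega>) (z j \<omega>)
                           + \<eta> j *\<^sub>R (\<theta> (int j) \<omega> - \<theta> (int j - 1) \<omega>)))"

text \<open>
  The oracle output at step \<open>j\<close> is a subgradient \<open>s j\<close> at \<open>\<theta> j\<close> plus centred noise \<open>n j\<close> with
  second moment at most \<open>\<sigma>\<^sup>2\<close>. Integrability is explicit because the Bochner integral of a
  non-integrable function is 0. The noise is only required to be independent of each of
  \<open>\<theta> j\<close>, \<open>s j\<close> and the other \<open>n i\<close> separately, not jointly.
\<close>

definition stochastic_subgradient ::
  "'w measure \<Rightarrow> (real ^ 'n \<Rightarrow> real) \<Rightarrow> real \<Rightarrow> (real ^ 'n \<Rightarrow> 'z \<Rightarrow> real ^ 'n) \<Rightarrow> (nat \<Rightarrow> 'w \<Rightarrow> 'z) \<Rightarrow>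
   (nat \<Rightarrow> 'w \<Rightarrow> real ^ 'n) \<Rightarrow> (nat \<Rightarrow> 'w \<Rightarrow> real ^ 'n) \<Rightarrow> (int \<Rightarrow> 'w \<Rightarrow> real ^ 'n) \<Rightarrow> bool" where
  "stochastic_subgradient P f \<sigma> g z s n \<theta> \<longleftrightarrow>
     (\<forall>j. \<forall>\<omega>\<in>space P. g (\<theta> (int j) \<omega>) (z j \<omega>) = s j \<omega> + n j \<omega> \<and>
                       s j \<omega> \<in> subdifferential f (\<theta> (int j) \<omega>)) \<and>
     (\<forall>j. integrable P (n j) \<and> integral\<^sup>L P (n j) = 0) \<and>
     (\<forall>j. integrable P (\<lambda>\<omega>. (norm (n j \<omega>))\<^sup>2) \<and> (\<integral>\<omega>. (norm (n j \<omega>))\<^sup>2 \<partial>P) \<le> \<sigma>\<^sup>2) \<and>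
     (\<forall>j. prob_space.indep_var P borel (n j) borel (\<theta> (int j))) \<and>
     (\<forall>j. prob_space.indep_var P borel (n j) borel (s j)) \<and>
     (\<forall>i j. i \<noteq> j \<longrightarrow> prob_space.indep_var P borel (n j) borel (n i))"

end

theory Submission
  imports Defs
begin

text \<open>
  Nonexpansiveness of the projection and strong convexity give
  \<open>u (j + 1) \<le> (1 - a m) u j + a\<^sup>2 (M + \<sigma>\<^sup>2) + C \<eta> j\<close> for \<open>u j = E \<parallel>\<theta> j - \<theta>star\<parallel>\<^sup>2\<close>: the noise
  enters linearly only against \<open>\<theta> j\<close> and \<open>s j\<close>, of which it is independent, while its correlation
  with \<open>\<theta> (j - 1)\<close> is absorbed into \<open>C \<eta> j\<close>. Averaging over \<open>j\<close> and Jensen's inequality bound the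
  error by a quantity with limit \<open>a (M + \<sigma>\<^sup>2) / m\<close>, half of the claimed bound. If \<open>M = 0\<close>, this
  limit may not be strictly below the bound, but then all iterates equal \<open>\<theta>star\<close>.
\<close>

section \<open>Moments of independent random vectors\<close>

text \<open>Expanding the inner product in coordinates reduces this to the product rule for
  independent real variables, since coordinates of independent vectors are independent.\<close>

lemma (in prob_space) indep_var_inner_integral:
  fixes X Y :: "'a \<Rightarrow> 'b::euclidean_space"
  assumes ind: "indep_var borel X borel Y" and X: "integrable M X" and Y: "integrable M Y"
  shows "integrable M (\<lambda>\<omega>. X \<omega> \<bullet> Y \<omega>)"
    and "expectation (\<lambda>\<omega>. X \<omega> \<bullet> Y \<omega>) = expectation X \<bullet> expectation Y"
proof -
  have ind_b: "indep_var borel (\<lambda>\<omega>. X \<omega> \<bullet> b) borel (\<lambda>\<omega>. Y \<omega> \<bullet> b)" for b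
    using indep_var_compose[OF ind, of "\<lambda>x. x \<bullet> b" borel "\<lambda>x. x \<bullet> b" borel]
    by (simp add: comp_def)
  have Xb: "integrable M (\<lambda>\<omega>. X \<omega> \<bullet> b)" and Yb: "integrable M (\<lambda>\<omega>. Y \<omega> \<bullet> b)" for b
    using X Y by simp_all
  have eq: "(\<lambda>\<omega>. X \<omega> \<bullet> Y \<omega>) = (\<lambda>\<omega>. \<Sum>b\<in>Basis. (X \<omega> \<bullet> b) * (Y \<omega> \<bullet> b))"
    by (rule ext, rule euclidean_inner)
  have prod: "integrable M (\<lambda>\<omega>. (X \<omega> \<bullet> b) * (Y \<omega> \<bullet> b))" for b
    by (rule indep_var_integrable[OF ind_b Xb Yb])
  then show "integrable M (\<lambda>\<omega>. X \<omega> \<bullet> Y \<omega>)"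
    unfolding eq by simp
  have "expectation (\<lambda>\<omega>. X \<omega> \<bullet> Y \<omega>)
      = (\<Sum>b\<in>Basis. expectation (\<lambda>\<omega>. (X \<omega> \<bullet> b) * (Y \<omega> \<bullet> b)))"
    unfolding eq using prod by (rule Bochner_Integration.integral_sum)
  also have "\<dots> = (\<Sum>b\<in>Basis. (expectation X \<bullet> b) * (expectation Y \<bullet> b))"
    using indep_var_lebesgue_integral[OF ind_b Xb Yb] X Y by simp
  also have "\<dots> = expectation X \<bullet> expectation Y"
    by (rule euclidean_inner[symmetric])
  finally show "expectation (\<lambda>\<omega>. X \<omega> \<bullet> Y \<omega>) = expectation X \<bullet> expectation Y" .
qed

text \<open>The cross term is an inner product of independent vectors, one of mean zero, so it
  integrates to zero and second moments add. It yields the bound \<open>M + \<sigma>\<^sup>2\<close>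
  for the oracle output.\<close>

lemma (in prob_space) integrable_norm_power2_add_centred:
  fixes S X :: "'a \<Rightarrow> 'b::euclidean_space"
  assumes ind: "indep_var borel X borel S"
    and X: "integrable M X" "expectation X = 0" "integrable M (\<lambda>\<omega>. (norm (X \<omega>))\<^sup>2)"
    and S: "integrable M S" "integrable M (\<lambda>\<omega>. (norm (S \<omega>))\<^sup>2)"
  shows "integrable M (\<lambda>\<omega>. (norm (S \<omega> + X \<omega>))\<^sup>2)"
    and "expectation (\<lambda>\<omega>. (norm (S \<omega> + X \<omega>))\<^sup>2)
      = expectation (\<lambda>\<omega>. (norm (S \<omega>))\<^sup>2) + expectation (\<lambda>\<omega>. (norm (X \<omega>))\<^sup>2)"
proof -
  have eq: "(\<lambda>\<omega>. (norm (S \<omega> + X \<omega>))\<^sup>2)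
      = (\<lambda>\<omega>. (norm (S \<omega>))\<^sup>2 + (norm (X \<omega>))\<^sup>2 + 2 * (X \<omega> \<bullet> S \<omega>))"
    by (simp add: fun_eq_iff power2_norm_eq_inner inner_simps inner_commute)
  note cross = indep_var_inner_integral[OF ind X(1) S(1)]
  show "integrable M (\<lambda>\<omega>. (norm (S \<omega> + X \<omega>))\<^sup>2)"
    unfolding eq using X S cross(1) by simp
  show "expectation (\<lambda>\<omega>. (norm (S \<omega> + X \<omega>))\<^sup>2)
      = expectation (\<lambda>\<omega>. (norm (S \<omega>))\<^sup>2) + expectation (\<lambda>\<omega>. (norm (X \<omega>))\<^sup>2)"
    unfolding eq using X S cross by simp
qed

section \<open>Deterministic inequalities for a single step\<close>

text \<open>The inner product of \<open>v\<close> with the momentum direction \<open>d\<close> is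
  removed by Young's inequality: once \<open>v\<close> contains noise, its correlation with
  \<open>d\<close> is not controlled, whereas its second moment is. What remains beyond a plain
  gradient step is linear in \<open>\<eta>\<close>.\<close>

lemma momentum_step_norm_bound:
  fixes x d v :: "'a::real_inner"
  assumes "0 \<le> \<eta>" "\<eta> \<le> 1" "norm x \<le> K" "norm d \<le> K"
  shows "(norm (x - a *\<^sub>R v + \<eta> *\<^sub>R d))\<^sup>2
    \<le> (norm x)\<^sup>2 - 2 * a * (v \<bullet> x) + a\<^sup>2 * (norm v)\<^sup>2
       + \<eta> * (4 * K\<^sup>2 + 2 * a\<^sup>2 * (norm v)\<^sup>2)"
proof -
  define w where "w = x - a *\<^sub>R v"
  have w: "(norm w)\<^sup>2 = (norm x)\<^sup>2 - 2 * a * (v \<bullet> x) + a\<^sup>2 * (norm v)\<^sup>2"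
    unfolding w_def power2_norm_eq_inner
    by (simp add: inner_simps inner_commute power2_eq_square algebra_simps)
  \<comment> \<open>Half of the parallelogram law: the mirrored vector
    \<open>x + a *\<^sub>R v\<close> has nonnegative squared norm.\<close>
  have w2: "(norm w)\<^sup>2 \<le> 2 * (norm x)\<^sup>2 + 2 * (a\<^sup>2 * (norm v)\<^sup>2)"
  proof -
    have "0 \<le> (norm (x + a *\<^sub>R v))\<^sup>2" by simp
    also have "\<dots> = (norm x)\<^sup>2 + 2 * a * (v \<bullet> x) + a\<^sup>2 * (norm v)\<^sup>2"
      unfolding power2_norm_eq_inner
      by (simp add: inner_simps inner_commute power2_eq_square algebra_simps)
    finally show ?thesis unfolding w by linarith
  qed
  have x2: "(norm x)\<^sup>2 \<le> K\<^sup>2" and d2: "(norm d)\<^sup>2 \<le> K\<^sup>2"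
    using assms by (simp_all add: power_mono)
  have "0 \<le> (norm (w - d))\<^sup>2" by simp
  then have wd: "2 * (w \<bullet> d) \<le> (norm w)\<^sup>2 + (norm d)\<^sup>2"
    unfolding power2_norm_eq_inner by (simp add: inner_simps inner_commute)
  \<comment> \<open>Replacing the square of \<open>\<eta>\<close> by \<open>\<eta>\<close> matters
    because only the plain averages of the momentum weights are assumed to vanish.\<close>
  have "\<eta>\<^sup>2 * (norm d)\<^sup>2 \<le> \<eta> * (norm d)\<^sup>2"
    using assms by (intro mult_right_mono) (simp_all add: power2_eq_square mult_left_le)
  moreover have "(norm (w + \<eta> *\<^sub>R d))\<^sup>2 = (norm w)\<^sup>2 + \<eta> * (2 * (w \<bullet> d)) + \<eta>\<^sup>2 * (norm d)\<^sup>2"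
    unfolding power2_norm_eq_inner
    by (simp add: inner_simps inner_commute power2_eq_square algebra_simps)
  ultimately have "(norm (w + \<eta> *\<^sub>R d))\<^sup>2 \<le> (norm w)\<^sup>2 + \<eta> * (2 * (w \<bullet> d) + (norm d)\<^sup>2)"
    by (simp add: algebra_simps)
  \<comment> \<open>Of \<open>4 * K\<^sup>2\<close>, one half comes from \<open>w2\<close> and the
    other from the two copies of the squared norm of \<open>d\<close>.\<close>
  also have "\<dots> \<le> (norm w)\<^sup>2 + \<eta> * (4 * K\<^sup>2 + 2 * a\<^sup>2 * (norm v)\<^sup>2)"
    using wd w2 x2 d2 assms(1) by (intro add_left_mono mult_left_mono) linarith+
  finally show ?thesis unfolding w by (simp add: w_def)
qed

text \<open>Strong convexity at \<open>x\<close>, tested at the minimizer, is combined with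
  \<open>f y \<le> f x\<close>. The constant \<open>m / 2\<close> later turns into the contraction
  factor \<open>1 - a * m\<close>.\<close>

lemma strongly_convex_over_inner_ge:
  assumes "strongly_convex_over m D f" "is_arg_min f (\<lambda>x. x \<in> D) y"
    and "x \<in> D" "v \<in> subdifferential f x"
  shows "m / 2 * (norm (x - y))\<^sup>2 \<le> v \<bullet> (x - y)"
proof -
  have "y \<in> D" and "f y \<le> f x"
    using assms(2,3) by (auto simp: is_arg_min_linorder)
  moreover from \<open>y \<in> D\<close> have "f y \<ge> f x + v \<bullet> (y - x) + m / 2 * (norm (y - x))\<^sup>2"
    using assms(1,3,4) unfolding strongly_convex_over_def by blast
  ultimately show ?thesis
    by (simp add: norm_minus_commute inner_diff_right)
qed

section \<open>Averages and the contraction recursion\<close>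

text \<open>Jensen's inequality for the squared norm, obtained from the triangle inequality and
  Cauchy-Schwarz.\<close>

lemma norm_average_power2_le:
  fixes x :: "nat \<Rightarrow> 'a::real_normed_vector"
  shows "(norm ((1 / (real N + 1)) *\<^sub>R (\<Sum>i=0..N. x i) - c))\<^sup>2
    \<le> (\<Sum>i=0..N. (norm (x i - c))\<^sup>2) / (real N + 1)"
proof -
  have eq: "(1 / (real N + 1)) *\<^sub>R (\<Sum>i=0..N. x i) - c
      = (1 / (real N + 1)) *\<^sub>R (\<Sum>i=0..N. x i - c)"
    by (simp add: sum_subtractf scaleR_diff_right sum_constant_scaleR add.commute)
  have "(norm (\<Sum>i=0..N. x i - c))\<^sup>2 \<le> (\<Sum>i=0..N. norm (x i - c))\<^sup>2"
    by (intro power_mono norm_sum) simp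
  also have "\<dots> \<le> (\<Sum>i=0..N. (norm (x i - c))\<^sup>2) * (real N + 1)"
    using sum_squared_le_sum_of_squares[of "\<lambda>i. norm (x i - c)" "{0..N}"]
    by (simp add: algebra_simps)
  finally have "(norm (\<Sum>i=0..N. x i - c))\<^sup>2 \<le> (\<Sum>i=0..N. (norm (x i - c))\<^sup>2) * (real N + 1)" .
  then show ?thesis
    unfolding eq by (simp add: power_divide divide_simps power2_eq_square mult_ac)
qed

lemma sum_le_of_contraction_step:
  fixes u b :: "nat \<Rightarrow> real"
  assumes "\<And>j. u (Suc j) \<le> (1 - c) * u j + b j" and "\<And>j. 0 \<le> u j"
  shows "c * (\<Sum>i=0..N. u i) \<le> u 0 + (\<Sum>i=0..N. b i)"
proof -
  \<comment> \<open>Keeping the last term makes the telescoping induction close; nonnegativity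
    discards it afterwards.\<close>
  have "c * (\<Sum>i=0..N. u i) + u (Suc N) \<le> u 0 + (\<Sum>i=0..N. b i)"
  proof (induction N)
    case 0
    then show ?case using assms(1)[of 0] by (simp add: algebra_simps)
  next
    case (Suc N)
    then show ?case using assms(1)[of "Suc N"] by (simp add: algebra_simps)
  qed
  then show ?thesis using assms(2)[of "Suc N"] by linarith
qed

text \<open>Dividing the summed recursion by \<open>c * (N + 1)\<close> leaves \<open>B / c\<close>
  plus two vanishing terms, one from the initial value and one from the averaged weights. The strict
  gap below \<open>R\<close> absorbs both.\<close>

lemma eventually_average_le_of_contraction_step:
  fixes u \<eta> :: "nat \<Rightarrow> real"
  assumes step: "\<And>j. u (Suc j) \<le> (1 - c) * u j + (B + C * \<eta> j)" and "\<And>j. 0 \<le> u j"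
    and "c > 0" and "B / c < R"
    and lim: "(\<lambda>j. (\<Sum>i=0..j. \<eta> i) / (real j + 1)) \<longlonglongrightarrow> 0"
  shows "\<forall>\<^sub>F N in sequentially. (\<Sum>i=0..N. u i) / (real N + 1) \<le> R"
proof -
  have "(\<lambda>N. u 0 / c / (real N + 1)) \<longlonglongrightarrow> 0"
    using tendsto_mult_right_zero[OF LIMSEQ_inverse_real_of_nat, of "u 0 / c"]
    by (simp add: field_simps)
  from tendsto_add[OF tendsto_add[OF this tendsto_const[of "B / c"]] tendsto_mult_right_zero[OF lim, of "C / c"]]
  have "(\<lambda>N. u 0 / c / (real N + 1) + B / c + C / c * ((\<Sum>i=0..N. \<eta> i) / (real N + 1)))
      \<longlonglongrightarrow> B / c"
    by simp
  then have "\<forall>\<^sub>F N in sequentially.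
      u 0 / c / (real N + 1) + B / c + C / c * ((\<Sum>i=0..N. \<eta> i) / (real N + 1)) < R"
    using \<open>B / c < R\<close> by (rule order_tendstoD)
  then show ?thesis
  proof eventually_elim
    case (elim N)
    have "c * (\<Sum>i=0..N. u i) \<le> u 0 + ((real N + 1) * B + C * (\<Sum>i=0..N. \<eta> i))"
      using sum_le_of_contraction_step[where b = "\<lambda>j. B + C * \<eta> j", OF step assms(2), of N]
      by (simp add: sum.distrib sum_distrib_left add.commute)
    then have "(\<Sum>i=0..N. u i) / (real N + 1)
        \<le> (u 0 + ((real N + 1) * B + C * (\<Sum>i=0..N. \<eta> i))) / c / (real N + 1)"
      using \<open>c > 0\<close> by (intro divide_right_mono) (simp_all add: field_simps)
    also have "\<dots> = u 0 / c / (real N + 1) + B / c + C / c * ((\<Sum>i=0..N. \<eta> i) / (real N + 1))"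
      using \<open>c > 0\<close> by (simp add: add_divide_distrib)
    finally show ?case using elim by linarith
  qed
qed

section \<open>Pathwise behaviour of the iterates\<close>

lemma sgm_iterates_in:
  assumes "sgm_iterates P D g z t \<eta> \<theta>" "closed D" "\<omega> \<in> space P"
  shows "\<theta> (int j) \<omega> \<in> D" and "\<theta> (int j - 1) \<omega> \<in> D"
proof -
  have in_D: "\<theta> (int j) \<omega> \<in> D" for j
  proof (cases j)
    case (Suc k)
    \<comment> \<open>Membership of the projection requires a nonempty set; the initial guess at
      \<open>\<omega>\<close> is a witness.\<close>
    have "D \<noteq> {}" using assms unfolding sgm_iterates_def by blast
    then have "\<theta> (int k + 1) \<omega> \<in> D"
      using assms closest_point_in_set[OF \<open>closed D\<close>] unfolding sgm_iterates_def by simp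
    then show ?thesis using Suc by (simp add: add.commute)
  qed (use assms in \<open>simp add: sgm_iterates_def\<close>)
  then show "\<theta> (int j) \<omega> \<in> D" .
  show "\<theta> (int j - 1) \<omega> \<in> D"
  proof (cases j)
    case 0
    then show ?thesis using assms by (simp add: sgm_iterates_def)
  next
    case (Suc k)
    then show ?thesis using in_D[of k] by simp
  qed
qed

text \<open>A point \<open>c\<close> of \<open>D\<close> is its own projection, so nonexpansiveness
  compares the new iterate with the unprojected step. Iterates stay in \<open>D\<close>, so both the
  error and the momentum direction are at most \<open>diameter D\<close> long.\<close>

lemma sgm_step_norm_bound:
  assumes sgm: "sgm_iterates P D g z t \<eta> \<theta>"
    and D: "compact D" "convex D" "c \<in> D"
    and \<eta>: "0 \<le> \<eta> j" "\<eta> j \<le> 1"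
    and \<omega>: "\<omega> \<in> space P"
    and v: "g (\<theta> (int j) \<omega>) (z j \<omega>) = v"
  shows "(norm (\<theta> (int (Suc j)) \<omega> - c))\<^sup>2
    \<le> (norm (\<theta> (int j) \<omega> - c))\<^sup>2 - 2 * t j * (v \<bullet> (\<theta> (int j) \<omega> - c)) + (t j)\<^sup>2 * (norm v)\<^sup>2
       + \<eta> j * (4 * (diameter D)\<^sup>2 + 2 * (t j)\<^sup>2 * (norm v)\<^sup>2)"
proof -
  note in_D = sgm_iterates_in[OF sgm compact_imp_closed[OF D(1)] \<omega>, of j]
  define x where "x = \<theta> (int j) \<omega> - c"
  define d where "d = \<theta> (int j) \<omega> - \<theta> (int j - 1) \<omega>"
  have "\<theta> (int (Suc j)) \<omega>
      = closest_point D (\<theta> (int j) \<omega> - t j *\<^sub>R v + \<eta> j *\<^sub>R d)"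
    using sgm \<omega> v unfolding sgm_iterates_def d_def by (simp add: add.commute)
  moreover have "closest_point D c = c"
    using D(3) by (rule closest_point_self)
  ultimately have "norm (\<theta> (int (Suc j)) \<omega> - c) \<le> norm (\<theta> (int j) \<omega> - t j *\<^sub>R v + \<eta> j *\<^sub>R d - c)"
    using closest_point_lipschitz[OF D(2) compact_imp_closed[OF D(1)], of "\<theta> (int j) \<omega> - t j *\<^sub>R v + \<eta> j *\<^sub>R d" c] D(3)
    by (auto simp: dist_norm)
  also have "\<dots> = norm (x - t j *\<^sub>R v + \<eta> j *\<^sub>R d)"
    by (simp add: x_def algebra_simps)
  finally have "(norm (\<theta> (int (Suc j)) \<omega> - c))\<^sup>2 \<le> (norm (x - t j *\<^sub>R v + \<eta> j *\<^sub>R d))\<^sup>2"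
    by (rule power_mono) simp
  moreover have "norm x \<le> diameter D" "norm d \<le> diameter D"
    using in_D D diameter_bounded_bound[OF compact_imp_bounded[OF D(1)]]
    by (simp_all add: x_def d_def flip: dist_norm)
  ultimately show ?thesis
    using momentum_step_norm_bound[OF \<eta>, of x "diameter D" d "t j" v]
    unfolding x_def by (meson order_trans)
qed

section \<open>Taking expectations along a stage\<close>

lemma (in prob_space) integrable_of_norm_bound:
  fixes X :: "'a \<Rightarrow> 'b::{banach, second_countable_topology}"
  assumes "X \<in> borel_measurable M" "\<And>\<omega>. \<omega> \<in> space M \<Longrightarrow> norm (X \<omega>) \<le> K"
  shows "integrable M X" "integrable M (\<lambda>\<omega>. (norm (X \<omega>))\<^sup>2)"
proof -
  show "integrable M X" using assms by (intro integrable_const_bound[of _ K]) auto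
  show "integrable M (\<lambda>\<omega>. (norm (X \<omega>))\<^sup>2)"
    using assms by (intro integrable_const_bound[of _ "K\<^sup>2"]) (auto intro!: AE_I2 power_mono)
qed

theorem theorem4:
  fixes D :: "(real ^ 'n) set"
    and f :: "real ^ 'n \<Rightarrow> real"
    and \<theta>star :: "real ^ 'n"
    and P :: "'w measure"
    and g :: "real ^ 'n \<Rightarrow> 'z \<Rightarrow> real ^ 'n"
    and z :: "nat \<Rightarrow> 'w \<Rightarrow> 'z"
    and s n :: "nat \<Rightarrow> 'w \<Rightarrow> real ^ 'n"
    and \<theta> :: "int \<Rightarrow> 'w \<Rightarrow> real ^ 'n"
    and t \<eta> :: "nat \<Rightarrow> real"
    and L m M \<sigma> a :: real
  assumes "prob_space P"
    and "compact D" and "convex D" and "diameter D \<le> L"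
    and "m > 0" and "strongly_convex_over m D f"
    and "is_arg_min f (\<lambda>x. x \<in> D) \<theta>star" and "\<theta>star \<in> interior D"
    and "stochastic_subgradient P f \<sigma> g z s n \<theta>"
    and "M \<ge> 0" and "\<And>x v. x \<in> D \<Longrightarrow> v \<in> subdifferential f x \<Longrightarrow> norm v \<le> sqrt M"
    and "sgm_iterates P D g z t \<eta> \<theta>"
    and "0 < a" and "a < 1 / m" and "\<And>j. t j = a"
    and "\<And>j. 0 \<le> \<eta> j" and "\<And>j. \<eta> j < 1"
    and "(\<lambda>j. (\<Sum>i=0..j. \<eta> i) / (real j + 1)) \<longlonglongrightarrow> 0"
  shows "\<exists>N\<^sub>a. \<forall>N\<ge>N\<^sub>a.
    (\<integral>\<omega>. (norm ((1 / (real N + 1)) *\<^sub>R (\<Sum>i=0..N. \<theta> (int i) \<omega>) - \<theta>star))\<^sup>2 \<partial>P)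
      \<le> 2 * (M + \<sigma>\<^sup>2) / m * a"
proof -
  interpret prob_space P by fact
  note sgm = \<open>sgm_iterates P D g z t \<eta> \<theta>\<close>
  have D: "compact D" "convex D" "\<theta>star \<in> D" "closed D"
    using assms(2,3,8) interior_subset compact_imp_closed by auto
  have v: "g (\<theta> (int j) \<omega>) (z j \<omega>) = s j \<omega> + n j \<omega>" "s j \<omega> \<in> subdifferential f (\<theta> (int j) \<omega>)"
    if "\<omega> \<in> space P" for j \<omega>
    using assms(9) that unfolding stochastic_subgradient_def by blast+
  have n: "integrable P (n j)" "expectation (n j) = 0"
      "integrable P (\<lambda>\<omega>. (norm (n j \<omega>))\<^sup>2)" "expectation (\<lambda>\<omega>. (norm (n j \<omega>))\<^sup>2) \<le> \<sigma>\<^sup>2"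
      "indep_var borel (n j) borel (\<theta> (int j))" "indep_var borel (n j) borel (s j)" for j
    using assms(9) unfolding stochastic_subgradient_def by blast+
  have in_D: "\<theta> (int j) \<omega> \<in> D" if "\<omega> \<in> space P" for j \<omega>
    using sgm_iterates_in(1)[OF sgm D(4) that] .
  define x where "x j \<omega> = \<theta> (int j) \<omega> - \<theta>star" for j \<omega>
  define u where "u j = expectation (\<lambda>\<omega>. (norm (x j \<omega>))\<^sup>2)" for j
  have s_bound: "norm (s j \<omega>) \<le> sqrt M" if "\<omega> \<in> space P" for j \<omega>
    using assms(11) in_D v(2) that by blast
  have descent: "m / 2 * (norm (x j \<omega>))\<^sup>2 \<le> s j \<omega> \<bullet> x j \<omega>" if "\<omega> \<in> space P" for j \<omega>
    unfolding x_def using strongly_convex_over_inner_ge[OF assms(6,7)] in_D v(2) that by blast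
  show ?thesis
  proof (cases "M = 0")
    case True
    \<comment> \<open>With \<open>M = 0\<close> every subgradient on \<open>D\<close> vanishes, and
      \<open>descent\<close> then forces the error to be zero.\<close>
    have zero: "\<theta> (int j) \<omega> = \<theta>star" if "\<omega> \<in> space P" for j \<omega>
      using descent[OF that, of j] s_bound[OF that, of j] True \<open>m > 0\<close>
      by (simp add: x_def mult_le_0_iff)
    have "(\<integral>\<omega>. (norm ((1 / (real N + 1)) *\<^sub>R (\<Sum>i=0..N. \<theta> (int i) \<omega>) - \<theta>star))\<^sup>2 \<partial>P) = (\<integral>\<omega>. 0 \<partial>P)" for N
      by (rule Bochner_Integration.integral_cong)
        (simp_all add: zero sum_constant_scaleR add.commute del: sum_constant)
    then show ?thesis using True \<open>m > 0\<close> \<open>0 < a\<close> by simp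
  next
    case False
    then have "M > 0" using \<open>M \<ge> 0\<close> by simp
    \<comment> \<open>Independence includes measurability of both variables; this is how
      \<open>s j\<close>, given only as some selection of subgradients, becomes measurable.\<close>
    have meas: "\<theta> (int j) \<in> borel_measurable P" "s j \<in> borel_measurable P" for j
      using indep_var_rv2[OF n(5)] indep_var_rv2[OF n(6)] by auto
    have s_int: "integrable P (s j)" "integrable P (\<lambda>\<omega>. (norm (s j \<omega>))\<^sup>2)" for j
      using integrable_of_norm_bound[OF meas(2) s_bound] by auto
    have x_int: "integrable P (x j)" "integrable P (\<lambda>\<omega>. (norm (x j \<omega>))\<^sup>2)" for j
    proof -
      have "norm (x j \<omega>) \<le> diameter D" if "\<omega> \<in> space P" for \<omega>
        using diameter_bounded_bound[OF compact_imp_bounded[OF D(1)] in_D[OF that] D(3)]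
        by (simp add: x_def dist_norm)
      moreover have "x j \<in> borel_measurable P"
        using meas(1)[of j] unfolding x_def by simp
      ultimately show "integrable P (x j)" "integrable P (\<lambda>\<omega>. (norm (x j \<omega>))\<^sup>2)"
        using integrable_of_norm_bound by blast+
    qed
    have "indep_var borel (n j) borel (x j)" for j
      using indep_var_compose[OF n(5)[of j], of "\<lambda>x. x" borel "\<lambda>y. y - \<theta>star" borel]
      by (simp add: comp_def x_def[abs_def])
    note nx = indep_var_inner_integral[OF this n(1) x_int(1)]
    note sn = integrable_norm_power2_add_centred[OF n(6,1-3) s_int]
    have s_le: "expectation (\<lambda>\<omega>. (norm (s j \<omega>))\<^sup>2) \<le> M" for j
    proof -
      have "(norm (s j \<omega>))\<^sup>2 \<le> M" if "\<omega> \<in> space P" for \<omega>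
        using power_mono[OF s_bound[OF that, of j], of 2] \<open>M \<ge> 0\<close> by simp
      then have "expectation (\<lambda>\<omega>. (norm (s j \<omega>))\<^sup>2) \<le> expectation (\<lambda>\<omega>. M)"
        by (intro integral_mono s_int) auto
      then show ?thesis by (simp add: prob_space)
    qed
    define B where "B = M + \<sigma>\<^sup>2"
    define V where "V j = expectation (\<lambda>\<omega>. (norm (s j \<omega> + n j \<omega>))\<^sup>2)" for j
    have V_le: "V j \<le> B" for j
      unfolding V_def B_def sn(2) using s_le[of j] n(4)[of j] by linarith
    \<comment> \<open>The coefficient of \<open>\<eta> j\<close> in the step bound, with the second
      moment of the oracle output replaced by its bound \<open>B\<close>.\<close>
    define C where "C = 4 * (diameter D)\<^sup>2 + 2 * a\<^sup>2 * B"
    have step: "u (Suc j) \<le> (1 - a * m) * u j + (a\<^sup>2 * B + C * \<eta> j)" for j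
    proof -
      \<comment> \<open>Only the subgradient part of the inner product is traded for the
        contraction. The noise part stays, because it has mean zero against
        \<open>x j\<close>.\<close>
      let ?rhs = "\<lambda>\<omega>. (1 - a * m) * (norm (x j \<omega>))\<^sup>2 - 2 * a * (n j \<omega> \<bullet> x j \<omega>)
          + a\<^sup>2 * (norm (s j \<omega> + n j \<omega>))\<^sup>2
          + \<eta> j * (4 * (diameter D)\<^sup>2 + 2 * a\<^sup>2 * (norm (s j \<omega> + n j \<omega>))\<^sup>2)"
      have "(norm (x (Suc j) \<omega>))\<^sup>2 \<le> ?rhs \<omega>" if "\<omega> \<in> space P" for \<omega>
      proof -
        have "a * (m * (norm (x j \<omega>))\<^sup>2) \<le> a * (2 * (s j \<omega> \<bullet> x j \<omega>))"
          using descent[OF that, of j] \<open>0 < a\<close> by (intro mult_left_mono) simp_all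
        then show ?thesis
          using sgm_step_norm_bound[OF sgm D(1-3) assms(16) less_imp_le[OF assms(17)] that v(1)[OF that], of j]
          unfolding \<open>\<And>j. t j = a\<close> x_def by (simp add: inner_add_left algebra_simps)
      qed
      then have "u (Suc j) \<le> expectation ?rhs"
        unfolding u_def by (intro integral_mono x_int) (simp_all add: x_int nx sn)
      also have "\<dots> = (1 - a * m) * u j + a\<^sup>2 * V j + \<eta> j * (4 * (diameter D)\<^sup>2 + 2 * a\<^sup>2 * V j)"
        using x_int[of j] nx[of j] sn(1)[of j] n(2)[of j] by (simp add: u_def V_def prob_space)
      also have "\<dots> \<le> (1 - a * m) * u j + a\<^sup>2 * B + \<eta> j * C"
        unfolding C_def using V_le[of j] assms(16)[of j]
        by (intro add_mono[OF add_left_mono] mult_left_mono add_left_mono) simp_all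
      finally show ?thesis by (simp add: algebra_simps)
    qed
    \<comment> \<open>The case \<open>M > 0\<close> is used here: positivity of \<open>B\<close>
      makes the limit \<open>a * B / m\<close> strictly smaller than the target, which is twice as
      large.\<close>
    have "B > 0" using \<open>M > 0\<close> unfolding B_def by (simp add: add_pos_nonneg)
    then have "a\<^sup>2 * B / (a * m) < 2 * B / m * a"
      using \<open>0 < a\<close> \<open>m > 0\<close> by (simp add: field_simps power2_eq_square)
    then have "\<forall>\<^sub>F N in sequentially. (\<Sum>i=0..N. u i) / (real N + 1) \<le> 2 * B / m * a"
      using \<open>0 < a\<close> \<open>m > 0\<close> assms(18)
      by (intro eventually_average_le_of_contraction_step[where \<eta> = \<eta> and B = "a\<^sup>2 * B" and C = C, OF step]) (simp_all add: u_def)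
    moreover have "(\<integral>\<omega>. (norm ((1 / (real N + 1)) *\<^sub>R (\<Sum>i=0..N. \<theta> (int i) \<omega>) - \<theta>star))\<^sup>2 \<partial>P)
        \<le> (\<Sum>i=0..N. u i) / (real N + 1)" for N
    proof -
      have "(\<integral>\<omega>. (norm ((1 / (real N + 1)) *\<^sub>R (\<Sum>i=0..N. \<theta> (int i) \<omega>) - \<theta>star))\<^sup>2 \<partial>P)
          \<le> (\<integral>\<omega>. (\<Sum>i=0..N. (norm (x i \<omega>))\<^sup>2) / (real N + 1) \<partial>P)"
        unfolding x_def using x_int(2)
        \<comment> \<open>This form of monotonicity asks for integrability and nonnegativity of the
          dominating side only.\<close>
        by (intro integral_mono' norm_average_power2_le) (simp_all add: x_def sum_nonneg)
      also have "\<dots> = (\<Sum>i=0..N. u i) / (real N + 1)"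
        using x_int(2) by (simp add: u_def)
      finally show ?thesis .
    qed
    ultimately show ?thesis
      unfolding eventually_sequentially B_def by (meson order_trans)
  qed
qed

end
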